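(* Let $\mathcal{R}$ be a finite chain ring with maximal ideal $\langle\gamma\rangle$, nilpotency index $s$ and residue field $\mathcal{R}/\langle\gamma\rangle\cong\mathbb{F}_q$. Let $\mathcal{C}\subseteq\mathcal{R}^n$ be a linear code of rank $K$ and suppose $q>n-K+1$. Then $\mathcal{C}$ is an MHD code if and only if its socle $\mathcal{C}_0=\mathcal{C}\cap\langle\gamma^{s-1}\rangle^n$ (viewed as a linear code over $\mathbb{F}_q$) is an MDS code.
   Context: $\mathcal{R}$ is a finite chain ring (not necessarily commutative) with maximal ideal $\langle\gamma\rangle=\gamma\mathcal{R}=\mathcal{R}\gamma$; $s$ is the nilpotency index of $\gamma$ (least positive integer with $\gamma^s=0$); $q$ is the size of the residue field. The socle of $\mathcal{R}$ is $\langle\gamma^{s-1}\rangle$ (with $\gamma^0=1$). A linear code of length $n$ ($n\ge1$) is a left $\mathcal{R}$-submodule $\mathcal{C}\subseteq\mathcal{R}^n$. Its rank $K$ is the minimal number of generators of $\mathcal{C}$. Homogeneous weight: put $M=\frac{q}{q-1}$. For $x\in\mathcal{R}$, $\mathrm{wt}_{\mathrm{Hom}}(x)=0$ if $x=0$, $=M$ if $x\in\langle\gamma^{s-1}\rangle\setminus\{0\}$, and $=1$ if $x\notin\langle\gamma^{s-1}\rangle$. For $x\in\mathcal{R}^n$, $\mathrm{wt}_{\mathrm{Hom}}(x)=\sum_{i=1}^n\mathrm{wt}_{\mathrm{Hom}}(x_i)$. For a linear code $\mathcal{C}\ne\{0\}$, $d_{\mathrm{Hom}}(\mathcal{C})=\min\{\mathrm{wt}_{\mathrm{Hom}}(c):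 c\in\mathcal{C}\setminus\{0\}\}$; by convention $d_{\mathrm{Hom}}(\{0\})=M(n+1)$. A linear code $\mathcal{C}\subseteq\mathcal{R}^n$ of rank $K$ is a Maximum Homogeneous Distance (MHD) code if $d_{\mathrm{Hom}}(\mathcal{C})>M(n-K)$. Socle of a code: $\mathcal{C}_0=\mathcal{C}\cap\langle\gamma^{s-1}\rangle^n$. Via the isomorphism $\mathcal{R}/\langle\gamma\rangle\to\langle\gamma^{s-1}\rangle$, $r+\langle\gamma\rangle\mapsto r\gamma^{s-1}$, applied coordinatewise, $\mathcal{C}_0$ is identified with a linear code $\overline{\mathcal{C}}\subseteq\mathbb{F}_q^n$, which has $\mathbb{F}_q$-dimension $K$. A linear code over $\mathbb{F}_q$ of length $n$ and dimension $k$ is MDS if its minimum Hamming distance equals $n-k+1$, where the zero code is given minimum Hamming distance $n+1$ by convention. *)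

theory Defs
  imports "HOL-Analysis.Cartesian_Space"
begin

section \<open>Finite chain rings\<close>

definition left_ideal :: "'a::ring_1 set \<Rightarrow> bool" where
  "left_ideal I \<longleftrightarrow> 0 \<in> I \<and> (\<forall>x\<in>I. \<forall>y\<in>I. x - y \<in> I) \<and> (\<forall>r. \<forall>x\<in>I. r * x \<in> I)"

definition right_ideal :: "'a::ring_1 set \<Rightarrow> bool" where
  "right_ideal I \<longleftrightarrow> 0 \<in> I \<and> (\<forall>x\<in>I. \<forall>y\<in>I. x - y \<in> I) \<and> (\<forall>r. \<forall>x\<in>I. x * r \<in> I)"

definition two_sided_ideal :: "'a::ring_1 set \<Rightarrow> bool" where
  "two_sided_ideal I \<longleftrightarrow> left_ideal I \<and> right_ideal I"

definition maximal_ideal :: "'a::ring_1 set \<Rightarrow> bool" where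
  "maximal_ideal I \<longleftrightarrow> two_sided_ideal I \<and> I \<noteq> UNIV \<and>
     (\<forall>J. two_sided_ideal J \<longrightarrow> I \<subseteq> J \<longrightarrow> J = I \<or> J = UNIV)"

definition principal_ideal :: "'a::ring_1 \<Rightarrow> 'a set" where
  "principal_ideal x = two_sided_ideal hull {x}"

definition chain_ring :: "'a::ring_1 itself \<Rightarrow> bool" where
  "chain_ring _ \<longleftrightarrow>
     (\<forall>I J :: 'a set. left_ideal I \<longrightarrow> left_ideal J \<longrightarrow> I \<subseteq> J \<or> J \<subseteq> I) \<and>
     (\<forall>I J :: 'a set. right_ideal I \<longrightarrow> right_ideal J \<longrightarrow> I \<subseteq> J \<or> J \<subseteq> I)"

definition nilpotency_index :: "'a::ring_1 \<Rightarrow> nat \<Rightarrow> bool" where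
  "nilpotency_index x s \<longleftrightarrow> 0 < s \<and> x ^ s = 0 \<and> (\<forall>t. 0 < t \<longrightarrow> t < s \<longrightarrow> x ^ t \<noteq> 0)"

text \<open>A quotient by a term-dependent ideal is not a type. The residue field is therefore a
  type \<open>'f\<close> together with a surjective ring homomorphism \<open>\<pi>\<close> with kernel \<open>I\<close>, which
  amounts to an isomorphism from the quotient ring by \<open>I\<close> onto \<open>'f\<close>.\<close>

definition quotient_map :: "'a::ring_1 set \<Rightarrow> ('a \<Rightarrow> 'f::ring_1) \<Rightarrow> bool" where
  "quotient_map I \<pi> \<longleftrightarrow>
     (\<forall>x y. \<pi> (x + y) = \<pi> x + \<pi> y) \<and> (\<forall>x y. \<pi> (x * y) = \<pi> x * \<pi> y) \<and> \<pi> 1 = 1 \<and>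
     surj \<pi> \<and> {x. \<pi> x = 0} = I"

section \<open>Linear codes over a ring\<close>

text \<open>The library's module locales need commutative scalars. Here \<open>r *s x\<close> multiplies every
  coordinate of \<open>x\<close> by \<open>r\<close> from the left.\<close>

definition linear_code :: "('a::ring_1 ^ 'n) set \<Rightarrow> bool" where
  "linear_code C \<longleftrightarrow> 0 \<in> C \<and> (\<forall>x\<in>C. \<forall>y\<in>C. x + y \<in> C) \<and> (\<forall>r. \<forall>x\<in>C. r *s x \<in> C)"

definition code_rank :: "('a::{finite,ring_1} ^ 'n::finite) set \<Rightarrow> nat" where
  "code_rank C = (LEAST k. \<exists>S. finite S \<and> card S = k \<and> linear_code hull S = C)"

section \<open>Homogeneous weight and MHD codes\<close>

text \<open>Below, \<open>q\<close> is the size of the residue field, \<open>\<gamma>\<close> a generator of the maximal ideal, and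
  \<open>s\<close> its nilpotency index.\<close>

definition hom_max :: "nat \<Rightarrow> real" where
  "hom_max q = real q / (real q - 1)"

definition hom_weight1 :: "nat \<Rightarrow> 'a::ring_1 \<Rightarrow> nat \<Rightarrow> 'a \<Rightarrow> real" where
  "hom_weight1 q \<gamma> s x =
     (if x = 0 then 0 else if x \<in> principal_ideal (\<gamma> ^ (s - 1)) then hom_max q else 1)"

definition hom_weight :: "nat \<Rightarrow> 'a::ring_1 \<Rightarrow> nat \<Rightarrow> 'a ^ 'n \<Rightarrow> real" where
  "hom_weight q \<gamma> s x = (\<Sum>i\<in>UNIV. hom_weight1 q \<gamma> s (x $ i))"

definition hom_distance ::
    "nat \<Rightarrow> 'a::{finite,ring_1} \<Rightarrow> nat \<Rightarrow> ('a ^ 'n::finite) set \<Rightarrow> real" where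
  "hom_distance q \<gamma> s C =
     (if C = {0} then hom_max q * (real CARD('n) + 1)
      else Min (hom_weight q \<gamma> s ` (C - {0})))"

definition MHD ::
    "nat \<Rightarrow> 'a::{finite,ring_1} \<Rightarrow> nat \<Rightarrow> ('a ^ 'n::finite) set \<Rightarrow> bool" where
  "MHD q \<gamma> s C \<longleftrightarrow> linear_code C \<and>
     hom_distance q \<gamma> s C > hom_max q * (real CARD('n) - real (code_rank C))"

section \<open>MDS codes over a finite field\<close>

definition hamming_dist :: "'f ^ 'n \<Rightarrow> 'f ^ 'n \<Rightarrow> nat" where
  "hamming_dist x y = card {i. x $ i \<noteq> y $ i}"

definition hamming_distance :: "('f::{finite,field} ^ 'n::finite) set \<Rightarrow> nat" where
  "hamming_distance D =
     (if D = {0} then CARD('n) + 1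
      else Min {hamming_dist x y | x y. x \<in> D \<and> y \<in> D \<and> x \<noteq> y})"

definition MDS :: "('f::{finite,field} ^ 'n::finite) set \<Rightarrow> bool" where
  "MDS D \<longleftrightarrow> vec.subspace D \<and>
     int (hamming_distance D) = int CARD('n) - int (vec.dim D) + 1"

section \<open>The socle of a code\<close>

definition code_socle :: "'a::ring_1 \<Rightarrow> nat \<Rightarrow> ('a ^ 'n) set \<Rightarrow> ('a ^ 'n) set" where
  "code_socle \<gamma> s C = C \<inter> {x. \<forall>i. x $ i \<in> principal_ideal (\<gamma> ^ (s - 1))}"

text \<open>The preimage of the socle under the coordinatewise isomorphism
  \<open>\<pi> r \<mapsto> r * \<gamma> ^ (s - 1)\<close> from the residue field onto the ideal
  generated by \<open>\<gamma> ^ (s - 1)\<close>.\<close>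

definition residue_code ::
    "('a::ring_1 \<Rightarrow> 'f) \<Rightarrow> 'a \<Rightarrow> nat \<Rightarrow> ('a ^ 'n) set \<Rightarrow> ('f ^ 'n) set" where
  "residue_code \<pi> \<gamma> s C =
     {(\<chi> i. \<pi> (r $ i)) | r. (\<chi> i. r $ i * \<gamma> ^ (s - 1)) \<in> code_socle \<gamma> s C}"

end

theory Submission
  imports Defs
begin

text \<open>Multiplication by \<open>\<gamma>\<close> maps a code \<open>C\<close> onto \<open>\<gamma> C\<close> with kernel the socle, so the
  socle has \<open>card C / card (\<gamma> C)\<close> elements. By Nakayama's lemma a minimal generating set
  of \<open>C\<close> is a basis of \<open>C / \<gamma> C\<close> over the residue field, hence this number is
  \<open>q ^ K\<close> and the socle has dimension \<open>K\<close>. On socle words the homogeneous weight is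
  \<open>M = q / (q - 1)\<close> times the Hamming weight, so there an MHD bound \<open>> M (n - K)\<close> is the
  Hamming bound \<open>\<ge> n - K + 1\<close>, which by Singleton's bound is the MDS property. A word
  \<open>c\<close> outside the socle has a nonzero multiple \<open>\<gamma> ^ k c\<close> in the socle, whose support lies
  in that of \<open>c\<close>; hence its homogeneous weight is at least \<open>n - K + 1\<close>, and
  \<open>n - K + 1 > M (n - K)\<close> is precisely the hypothesis \<open>q > n - K + 1\<close>.\<close>

section \<open>Counting\<close>

text \<open>Both images are in bijection with the classes of the common kernel relation. Used where
  two codes arise as images of one set of coefficient vectors.\<close>

lemma card_image_eq_if_same_kernel:
  assumes "\<And>x y. x \<in> A \<Longrightarrow> y \<in> A \<Longrightarrow> f x = f y \<longleftrightarrow> g x = g y"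
  shows "card (f ` A) = card (g ` A)"
proof -
  have "bij_betw (\<lambda>z. g (inv_into A f z)) (f ` A) (g ` A)"
  proof (rule bij_betw_imageI)
    show "inj_on (\<lambda>z. g (inv_into A f z)) (f ` A)"
      by (rule inj_onI) (metis assms f_inv_into_f inv_into_into)
    have "g (inv_into A f (f x)) = g x" if "x \<in> A" for x
      using that by (metis assms f_inv_into_f image_eqI inv_into_into)
    then show "(\<lambda>z. g (inv_into A f z)) ` f ` A = g ` A"
      by (force simp: image_image)
  qed
  then show ?thesis by (rule bij_betw_same_card)
qed

text \<open>Counting form of the first isomorphism theorem: with one preimage chosen for each value,
  \<open>A\<close> splits into translates of the kernel.\<close>

lemma card_additive_image_kernel:
  fixes f :: "'a::group_add \<Rightarrow> 'b::group_add"
  assumes add: "\<And>x y. x \<in> A \<Longrightarrow> y \<in> A \<Longrightarrow> x + y \<in> A"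
    and uminus: "\<And>x. x \<in> A \<Longrightarrow> - x \<in> A"
    and hom: "\<And>x y. f (x + y) = f x + f y"
  shows "card A = card (f ` A) * card {x \<in> A. f x = 0}"
proof -
  let ?g = "inv_into A f"
  have f0: "f 0 = 0" using hom[of 0 0] by (metis add_0 add_right_cancel)
  have fm: "f (- x) = - f x" for x
    using hom[of "- x" x] f0 by (simp add: eq_neg_iff_add_eq_0)
  have "bij_betw (\<lambda>(y, k). ?g y + k) (f ` A \<times> {x \<in> A. f x = 0}) A"
  proof (rule bij_betw_imageI)
    have fg: "f (?g y + k) = y" if "y \<in> f ` A" "f k = 0" for y k
      using that by (simp add: hom f_inv_into_f)
    show "inj_on (\<lambda>(y, k). ?g y + k) (f ` A \<times> {x \<in> A. f x = 0})"
    proof (rule inj_onI, clarify)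
      fix u v x y
      assume *: "u \<in> A" "v \<in> A" "f x = 0" "f y = 0" "?g (f u) + x = ?g (f v) + y"
      then have "f u = f v" by (metis fg imageI)
      with * show "f u = f v \<and> x = y" by simp
    qed
    show "(\<lambda>(y, k). ?g y + k) ` (f ` A \<times> {x \<in> A. f x = 0}) = A"
    proof
      show "(\<lambda>(y, k). ?g y + k) ` (f ` A \<times> {x \<in> A. f x = 0}) \<subseteq> A"
        by (auto intro!: add inv_into_into)
      show "A \<subseteq> (\<lambda>(y, k). ?g y + k) ` (f ` A \<times> {x \<in> A. f x = 0})"
      proof
        fix x assume x: "x \<in> A"
        then have g: "?g (f x) \<in> A" "f (?g (f x)) = f x"
          by (auto simp: f_inv_into_f inv_into_into)
        have "- ?g (f x) + x \<in> A" "f (- ?g (f x) + x) = 0"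
          using g x by (auto simp: hom fm intro: add uminus)
        moreover have "x = ?g (f x) + (- ?g (f x) + x)"
          by (simp add: add.assoc[symmetric])
        ultimately show "x \<in> (\<lambda>(y, k). ?g y + k) ` (f ` A \<times> {x \<in> A. f x = 0})"
          using x by (intro rev_image_eqI[of "(f x, - ?g (f x) + x)"]) auto
      qed
    qed
  qed
  then have "card (f ` A \<times> {x \<in> A. f x = 0}) = card A" by (rule bij_betw_same_card)
  then show ?thesis by (simp add: card_cartesian_product)
qed

text \<open>A basis assigns coordinates. Coefficient functions are taken extensional on
  \<open>B\<close>, so that each vector corresponds to exactly one of them.\<close>

lemma card_subspace:
  fixes D :: "('f::{finite,field} ^ 'n::finite) set"
  assumes "vec.subspace D"
  shows "card D = CARD('f) ^ vec.dim D"
proof -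
  obtain B where B: "B \<subseteq> D" "vec.independent B" "D \<subseteq> vec.span B" "card B = vec.dim D"
    using vec.basis_exists[of D] by blast
  have D: "D = vec.span B"
    using B assms by (metis vec.span_subspace)
  have fin: "finite B" by simp
  let ?comb = "\<lambda>f. \<Sum>b\<in>B. f b *s b"
  have "inj_on ?comb (B \<rightarrow>\<^sub>E UNIV)"
  proof (rule inj_onI)
    fix f g assume fg: "f \<in> B \<rightarrow>\<^sub>E UNIV" "g \<in> B \<rightarrow>\<^sub>E UNIV" "?comb f = ?comb g"
    then have "(\<Sum>b\<in>B. (f b - g b) *s b) = 0"
      by (simp add: vec.scale_left_diff_distrib sum_subtractf)
    then have "f b - g b = 0" if "b \<in> B" for b
      using vec.independentD[OF B(2) fin subset_refl, of "\<lambda>b. f b - g b"] that by blast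
    then show "f = g" using fg by (intro PiE_ext[of f B "\<lambda>_. UNIV" g]) auto
  qed
  moreover have "?comb ` (B \<rightarrow>\<^sub>E UNIV) = D"
  proof -
    have "?comb f \<in> ?comb ` (B \<rightarrow>\<^sub>E UNIV)" for f
      by (rule rev_image_eqI[of "restrict f B"]) auto
    then have "range ?comb \<subseteq> ?comb ` (B \<rightarrow>\<^sub>E UNIV)" by (rule image_subsetI)
    moreover have "?comb ` (B \<rightarrow>\<^sub>E UNIV) \<subseteq> range ?comb" by (rule image_mono) simp
    ultimately show ?thesis unfolding D vec.span_finite[OF fin] by (rule antisym[rotated])
  qed
  ultimately have "card D = card (B \<rightarrow>\<^sub>E (UNIV :: 'f set))"
    using card_image by fastforce
  then show ?thesis using B(4) fin by (simp add: card_PiE)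
qed

section \<open>Linear codes\<close>

lemma linear_code_sum:
  "linear_code C \<Longrightarrow> (\<And>i. i \<in> I \<Longrightarrow> f i \<in> C) \<Longrightarrow> sum f I \<in> C"
  by (induction I rule: infinite_finite_induct) (auto simp: linear_code_def)

lemma linear_code_uminus:
  fixes C :: "('a::ring_1 ^ 'n) set"
  shows "linear_code C \<Longrightarrow> x \<in> C \<Longrightarrow> - x \<in> C"
  unfolding linear_code_def by (metis vector_sneg_minus1)

lemma linear_code_diff:
  fixes C :: "('a::ring_1 ^ 'n) set"
  shows "linear_code C \<Longrightarrow> x \<in> C \<Longrightarrow> y \<in> C \<Longrightarrow> x - y \<in> C"
  using linear_code_uminus[of C y] by (metis linear_code_def add_uminus_conv_diff)

lemma linear_code_hull_finite:
  fixes S :: "('a::ring_1 ^ 'n) set"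
  assumes "finite S"
  shows "linear_code hull S = range (\<lambda>f. \<Sum>x\<in>S. f x *s x)"
proof (rule hull_unique)
  show "S \<subseteq> range (\<lambda>f. \<Sum>x\<in>S. f x *s x)"
  proof
    fix y assume "y \<in> S"
    then have "(\<Sum>x\<in>S. (if x = y then 1 else 0) *s x) = y"
      using assms by (simp add: if_distrib[of "\<lambda>c. c *s _"] sum.delta' cong: if_cong)
    then show "y \<in> range (\<lambda>f. \<Sum>x\<in>S. f x *s x)"
      by (intro range_eqI[of _ _ "\<lambda>x. if x = y then 1 else 0"]) simp
  qed
  show "linear_code (range (\<lambda>f. \<Sum>x\<in>S. f x *s x))"
    unfolding linear_code_def
  proof (intro conjI ballI allI)
    show "0 \<in> range (\<lambda>f. \<Sum>x\<in>S. f x *s x)"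
      by (rule range_eqI[of _ _ "\<lambda>_. 0"]) simp
  next
    fix x y assume "x \<in> range (\<lambda>f. \<Sum>x\<in>S. f x *s x)" "y \<in> range (\<lambda>f. \<Sum>x\<in>S. f x *s x)"
    then obtain f g where "x = (\<Sum>x\<in>S. f x *s x)" "y = (\<Sum>x\<in>S. g x *s x)" by blast
    then show "x + y \<in> range (\<lambda>f. \<Sum>x\<in>S. f x *s x)"
      by (intro range_eqI[of _ _ "\<lambda>z. f z + g z"])
         (simp add: vector_sadd_rdistrib sum.distrib)
  next
    fix r x assume "x \<in> range (\<lambda>f. \<Sum>x\<in>S. f x *s x)"
    then obtain f where f: "x = (\<Sum>x\<in>S. f x *s x)" by blast
    have "r *s (\<Sum>x\<in>S. f x *s x) = (\<Sum>x\<in>S. r *s (f x *s x))"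
      by (simp add: vec_eq_iff sum_distrib_left)
    then show "r *s x \<in> range (\<lambda>f. \<Sum>x\<in>S. f x *s x)"
      by (intro range_eqI[of _ _ "\<lambda>z. r * f z"]) (simp add: f vector_smult_assoc)
  qed
  show "range (\<lambda>f. \<Sum>x\<in>S. f x *s x) \<subseteq> T" if "S \<subseteq> T" "linear_code T" for T
    using that by (auto intro!: linear_code_sum) (auto simp: linear_code_def)
qed

lemma code_rank_generators:
  fixes C :: "('a::{finite,ring_1} ^ 'n::finite) set"
  assumes "linear_code C"
  obtains S where "linear_code hull S = C" "card S = code_rank C"
proof -
  have "\<exists>k S. finite S \<and> card S = k \<and> linear_code hull S = C"
    using hull_same[of linear_code C] assms finite by blast
  from LeastI_ex[OF this] show ?thesis
    using that unfolding code_rank_def by blast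
qed

lemma code_rank_le:
  fixes S :: "('a::{finite,ring_1} ^ 'n::finite) set"
  shows "code_rank (linear_code hull S) \<le> card S"
  unfolding code_rank_def by (rule Least_le) (auto intro: exI[of _ S])

section \<open>Hamming distance\<close>

text \<open>Supports are sets of positions and do not depend on the alphabet, so they allow words
  over the ring to be compared with words over the residue field.\<close>

definition support :: "'a::zero ^ 'n \<Rightarrow> 'n set" where
  "support x = {i. x $ i \<noteq> 0}"

lemma support_eq_empty_iff: "support x = {} \<longleftrightarrow> x = 0"
  by (auto simp: support_def vec_eq_iff)

text \<open>Linearity turns distances into weights of differences. Stating it as a lower bound
  removes the minimum from later arguments.\<close>

lemma hamming_distance_ge_iff:
  fixes D :: "('f::{finite,field} ^ 'n::finite) set"
  assumes D: "vec.subspace D" "D \<noteq> {0}"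
  shows "m \<le> hamming_distance D \<longleftrightarrow> (\<forall>x\<in>D - {0}. m \<le> card (support x))"
proof -
  have eq: "{hamming_dist x y | x y. x \<in> D \<and> y \<in> D \<and> x \<noteq> y} = (\<lambda>x. card (support x)) ` (D - {0})"
    (is "?L = ?R")
  proof
    have "hamming_dist x y = card (support (x - y))" for x y :: "'f ^ 'n"
      by (simp add: hamming_dist_def support_def)
    then show "?L \<subseteq> ?R" using D(1) by (auto intro!: imageI vec.subspace_diff)
    have "card (support x) = hamming_dist x 0" for x :: "'f ^ 'n"
      by (simp add: hamming_dist_def support_def)
    then show "?R \<subseteq> ?L" using vec.subspace_0[OF D(1)] by blast
  qed
  have "D - {0} \<noteq> {}" using D vec.subspace_0[OF D(1)] by blast
  then show ?thesis
    using D(2) by (simp add: hamming_distance_def eq)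
qed

text \<open>By the pigeonhole principle, projection to \<open>vec.dim D - 1\<close> coordinates is
  not injective on \<open>D\<close>. Two distinct words agree there, so their difference is a
  nonzero word vanishing on \<open>J\<close>.\<close>

lemma singleton_bound:
  fixes D :: "('f::{finite,field} ^ 'n::finite) set"
  assumes D: "vec.subspace D" "D \<noteq> {0}"
  shows "hamming_distance D + vec.dim D \<le> CARD('n) + 1"
proof -
  have dim: "vec.dim D \<noteq> 0" using D vec.subspace_0 by auto
  have "vec.dim D \<le> CARD('n)" by (rule dim_subset_UNIV_cart_gen)
  then obtain J :: "'n set" where J: "card J = vec.dim D - 1"
    by (metis obtain_subset_with_card_n diff_le_self le_trans)
  have q: "CARD('f) > 1"
    using card_mono[of UNIV "{0, 1 :: 'f}"] by simp
  let ?p = "\<lambda>x. \<lambda>i\<in>J. x $ i"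
  have "?p ` D \<subseteq> J \<rightarrow>\<^sub>E UNIV" by auto
  then have "card (?p ` D) \<le> CARD('f) ^ card J"
    using card_mono[of "J \<rightarrow>\<^sub>E (UNIV :: 'f set)" "?p ` D"] by (simp add: card_PiE finite_PiE)
  also have "\<dots> < card D"
    using q dim power_strict_increasing[of "vec.dim D - 1" "vec.dim D" "CARD('f)"]
    by (simp only: J card_subspace[OF D(1)])
  finally have "\<not> inj_on ?p D" by (metis pigeonhole)
  then obtain x y where xy: "x \<in> D" "y \<in> D" "x \<noteq> y" "?p x = ?p y"
    by (auto simp: inj_on_def)
  have "support (x - y) \<subseteq> - J"
    using xy(4) by (auto simp: support_def restrict_def fun_eq_iff) (metis)
  then have "card (support (x - y)) \<le> CARD('n) - card J"
    using card_mono[of "- J" "support (x - y)"] by (simp add: Compl_eq_Diff_UNIV card_Diff_subset)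
  moreover have "hamming_distance D \<le> card (support (x - y))"
    using hamming_distance_ge_iff[OF D, of "hamming_distance D"] xy vec.subspace_diff[OF D(1)]
    by auto
  ultimately show ?thesis
    using J dim \<open>vec.dim D \<le> CARD('n)\<close> by linarith
qed

section \<open>Finite chain rings\<close>

text \<open>A ring with such a map is automatically a chain ring with maximal ideal
  \<open>range (\<lambda>r. r * \<gamma>)\<close>: every nonzero element is a power of \<open>\<gamma>\<close> times a unit.\<close>

locale residue_field_map =
  fixes \<gamma> :: "'a::{finite,ring_1}" and s :: nat and \<pi> :: "'a \<Rightarrow> 'f::{finite,field}"
  assumes range_comm: "range (\<lambda>r. \<gamma> * r) = range (\<lambda>r. r * \<gamma>)"
    and nilpotent: "nilpotency_index \<gamma> s"
    and quotient: "quotient_map (range (\<lambda>r. r * \<gamma>)) \<pi>"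
begin

lemma
  shows s_pos: "0 < s" and gamma_pow_s: "\<gamma> ^ s = 0"
    and gamma_pow_less: "0 < t \<Longrightarrow> t < s \<Longrightarrow> \<gamma> ^ t \<noteq> 0"
  using nilpotent by (auto simp: nilpotency_index_def)

lemma gamma_pow_eq_0_iff: "\<gamma> ^ t = 0 \<longleftrightarrow> s \<le> t"
proof
  show "\<gamma> ^ t = 0 \<Longrightarrow> s \<le> t" by (cases "t = 0") (use gamma_pow_less[of t] not_le in auto)
  show "s \<le> t \<Longrightarrow> \<gamma> ^ t = 0"
    by (metis gamma_pow_s le_add_diff_inverse mult_zero_left power_add)
qed

lemma
  shows pi_add: "\<pi> (x + y) = \<pi> x + \<pi> y" and pi_mult: "\<pi> (x * y) = \<pi> x * \<pi> y"
    and pi_1: "\<pi> 1 = 1" and surj_pi: "surj \<pi>"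
  using quotient by (auto simp: quotient_map_def)

lemma pi_eq_0_iff: "\<pi> x = 0 \<longleftrightarrow> (\<exists>r. x = r * \<gamma>)"
proof -
  have "{x. \<pi> x = 0} = range (\<lambda>r. r * \<gamma>)" using quotient by (simp add: quotient_map_def)
  then show ?thesis by blast
qed

lemma pi_eq_0_iff': "\<pi> x = 0 \<longleftrightarrow> (\<exists>r. x = \<gamma> * r)"
  using pi_eq_0_iff range_comm by blast

lemma pi_0: "\<pi> 0 = 0"
  using pi_add[of 0 0] by (metis add_0 add_right_cancel)

lemma pi_diff: "\<pi> (x - y) = \<pi> x - \<pi> y"
  using pi_add[of "x - y" y] by simp

text \<open>Substitute for commutativity: a power of \<gamma> can be moved across a factor at the
  cost of changing that factor.\<close>

lemma range_pow_comm: "range (\<lambda>r. \<gamma> ^ k * r) = range (\<lambda>r. r * \<gamma> ^ k)"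
proof (induction k)
  case 0
  show ?case by simp
next
  case (Suc k)
  have "range (\<lambda>r. \<gamma> ^ Suc k * r) = (*) \<gamma> ` range (\<lambda>r. \<gamma> ^ k * r)"
    by (simp add: image_image mult.assoc)
  also have "\<dots> = (\<lambda>x. x * \<gamma> ^ k) ` range (\<lambda>r. \<gamma> * r)"
    by (simp add: Suc image_image mult.assoc)
  also have "\<dots> = range (\<lambda>r. r * \<gamma> ^ Suc k)"
    by (simp add: range_comm image_image mult.assoc)
  finally show ?case .
qed

lemma gamma_pow_mult_right: "\<exists>r'. \<gamma> ^ k * r = r' * \<gamma> ^ k"
  using range_pow_comm[of k] by blast

lemma gamma_pow_mult_left: "\<exists>r'. r * \<gamma> ^ k = \<gamma> ^ k * r'"
  using range_pow_comm[of k] by blast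

lemma principal_ideal_gamma_pow: "principal_ideal (\<gamma> ^ k) = range (\<lambda>r. r * \<gamma> ^ k)"
  unfolding principal_ideal_def
proof (rule hull_unique)
  let ?I = "range (\<lambda>r. r * \<gamma> ^ k)"
  show "{\<gamma> ^ k} \<subseteq> ?I" by (auto intro: range_eqI[of _ _ 1])
  have "left_ideal ?I"
    unfolding left_ideal_def
    by (auto simp: left_diff_distrib[symmetric] mult.assoc[symmetric] intro: range_eqI[of _ _ 0])
  moreover have "r * \<gamma> ^ k * x \<in> ?I" for r x
    by (metis gamma_pow_mult_right mult.assoc rangeI)
  ultimately show "two_sided_ideal ?I"
    by (auto simp: two_sided_ideal_def right_ideal_def left_ideal_def)
  show "?I \<subseteq> T" if "{\<gamma> ^ k} \<subseteq> T" "two_sided_ideal T" for T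
    using that by (auto simp: two_sided_ideal_def left_ideal_def)
qed

text \<open>Substituting \<open>y = x * y\<close> into itself extracts one more left factor \<gamma>
  each time, until \<gamma>^s = 0 appears. In effect, left multiplication by \<open>1 - x\<close> is
  injective.\<close>

lemma nilpotent_absorb:
  assumes "\<pi> x = 0" "y = x * y"
  shows "y = 0"
proof -
  obtain r where r: "x = \<gamma> * r" using assms(1) pi_eq_0_iff' by blast
  have "\<exists>z. y = \<gamma> ^ k * z" for k
  proof (induction k)
    case (Suc k)
    then obtain z where z: "y = \<gamma> ^ k * z" by blast
    obtain r' where "r * \<gamma> ^ k = \<gamma> ^ k * r'" using gamma_pow_mult_left by blast
    then have "y = \<gamma> ^ Suc k * (r' * z)"
      using assms(2) z r by (metis mult.assoc power_Suc)
    then show ?case by blast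
  qed simp
  from this[of s] show "y = 0" by (auto simp: gamma_pow_s)
qed

text \<open>If \<open>w\<close> lifts the inverse of \<open>\<pi> u\<close>, then
  \<open>1 - w * u\<close> lies in the kernel, so left multiplication by \<open>u\<close> is
  injective. Finiteness makes it surjective, which gives a right inverse \<open>v\<close>;
  cancelling \<open>u\<close> in \<open>u * (v * u) = u\<close> shows that \<open>v\<close> is
  two-sided.\<close>

lemma unit_if_pi_nonzero:
  assumes "\<pi> u \<noteq> 0"
  obtains v where "u * v = 1" "v * u = 1"
proof -
  obtain w where w: "\<pi> w = inverse (\<pi> u)" using surj_pi by (metis surjD)
  have "inj ((*) u)"
  proof (rule injI)
    fix x y assume "u * x = u * y"
    then have "(w * u) * (x - y) = 0" by (simp add: right_diff_distrib mult.assoc)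
    then have "x - y = (1 - w * u) * (x - y)" by (simp add: left_diff_distrib)
    moreover have "\<pi> (1 - w * u) = 0" using assms w by (simp add: pi_diff pi_mult pi_1)
    ultimately show "x = y" using nilpotent_absorb by (metis eq_iff_diff_eq_0)
  qed
  moreover from this obtain v where v: "u * v = 1"
    using finite_UNIV_inj_surj[of "(*) u"] by (metis finite surjD)
  ultimately have "v * u = 1" by (metis injD mult.assoc mult.right_neutral mult_1)
  with v show ?thesis using that by blast
qed

lemma gamma_pow_decomposition:
  assumes "x \<noteq> 0"
  obtains k u where "k < s" "x = \<gamma> ^ k * u" "\<pi> u \<noteq> 0"
proof -
  \<comment> \<open>Invariant of pulling out factors of \<gamma>: after \<open>t\<close> rounds
    either a unit cofactor has been reached or all \<open>t\<close> factors have come out. At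
    \<open>t = s\<close> the second case would force \<open>x = 0\<close>.\<close>
  have "\<exists>k u. k < t \<and> x = \<gamma> ^ k * u \<and> \<pi> u \<noteq> 0 \<or> x = \<gamma> ^ t * u" for t
  proof (induction t)
    case (Suc t)
    then consider k u where "k < t" "x = \<gamma> ^ k * u" "\<pi> u \<noteq> 0" | u where "x = \<gamma> ^ t * u"
      by blast
    then show ?case
    proof cases
      case 1
      then show ?thesis by (metis less_SucI)
    next
      case 2
      show ?thesis
      proof (cases "\<pi> u = 0")
        case True
        then obtain r where "u = \<gamma> * r" using pi_eq_0_iff' by blast
        with 2 have "x = \<gamma> ^ Suc t * r" by (simp add: mult.assoc[symmetric] power_commutes)
        then show ?thesis by blast
      next
        case False
        with 2 show ?thesis by blast
      qed
    qed
  qed (auto intro: exI[of _ x])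
  from this[of s] show ?thesis using that assms by (auto simp: gamma_pow_s)
qed

text \<open>Makes the socle a kernel, so that it can be counted. If \<gamma> kills \<gamma>^k u with
  \<open>u\<close> a unit, then \<gamma>^(k+1) = 0, and \<open>k < s\<close> leaves only
  \<open>k = s - 1\<close>.\<close>

lemma socle_iff_annihilated: "x \<in> principal_ideal (\<gamma> ^ (s - 1)) \<longleftrightarrow> \<gamma> * x = 0"
proof
  assume "x \<in> principal_ideal (\<gamma> ^ (s - 1))"
  then obtain r where "x = \<gamma> ^ (s - 1) * r"
    using principal_ideal_gamma_pow range_pow_comm by blast
  then show "\<gamma> * x = 0"
    by (metis gamma_pow_s mult.assoc mult_zero_left power_minus_mult power_commutes s_pos)
next
  assume *: "\<gamma> * x = 0"
  show "x \<in> principal_ideal (\<gamma> ^ (s - 1))"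
  proof (cases "x = 0")
    case False
    then obtain k u where ku: "k < s" "x = \<gamma> ^ k * u" "\<pi> u \<noteq> 0"
      using gamma_pow_decomposition by blast
    obtain v where "u * v = 1" using ku(3) unit_if_pi_nonzero by blast
    then have "\<gamma> ^ Suc k = \<gamma> * x * v" using ku(2) by (simp add: mult.assoc)
    then have "s \<le> Suc k" using * gamma_pow_eq_0_iff[of "Suc k"] by simp
    then have "k = s - 1" using ku(1) by simp
    then show ?thesis
      unfolding principal_ideal_gamma_pow range_pow_comm[symmetric] using ku(2) by blast
  qed (simp add: principal_ideal_gamma_pow image_iff exI[of _ 0])
qed

text \<open>This is why \<pi> r \<mapsto> r \<gamma>^(s-1) is well defined and injective on the
  residue field: a unit \<open>r\<close> cannot kill the nonzero element \<gamma>^(s-1).\<close>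

lemma mult_socle_generator_eq_0_iff: "r * \<gamma> ^ (s - 1) = 0 \<longleftrightarrow> \<pi> r = 0"
proof
  assume *: "r * \<gamma> ^ (s - 1) = 0"
  show "\<pi> r = 0"
  proof (rule ccontr)
    assume "\<pi> r \<noteq> 0"
    then obtain v where "v * r = 1" using unit_if_pi_nonzero by blast
    then have "\<gamma> ^ (s - 1) = v * (r * \<gamma> ^ (s - 1))" by (simp add: mult.assoc[symmetric])
    with * show False using s_pos gamma_pow_eq_0_iff[of "s - 1"] by simp
  qed
next
  assume "\<pi> r = 0"
  then obtain r' where "r = r' * \<gamma>" using pi_eq_0_iff by blast
  then show "r * \<gamma> ^ (s - 1) = 0"
    by (metis gamma_pow_s mult.assoc mult_zero_right power_Suc Suc_pred' s_pos)
qed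

section \<open>The size of the socle of a code\<close>

lemma code_socle_eq: "code_socle \<gamma> s C = {c \<in> C. \<gamma> *s c = 0}"
  by (auto simp: code_socle_def socle_iff_annihilated vec_eq_iff simp del: One_nat_def)

text \<open>Since \<gamma> need not be central, closure under left scalars rests on rewriting
  \<open>r * \<gamma>\<close> as \<open>\<gamma> * r'\<close>.\<close>

lemma linear_code_gamma_image:
  fixes C :: "('a ^ 'n) set"
  assumes "linear_code C"
  shows "linear_code ((*s) \<gamma> ` C)"
  unfolding linear_code_def
proof (intro conjI ballI allI)
  show "0 \<in> (*s) \<gamma> ` C" using assms by (force simp: linear_code_def)
  show "x + y \<in> (*s) \<gamma> ` C" if "x \<in> (*s) \<gamma> ` C" "y \<in> (*s) \<gamma> ` C" for x y
    using that assms by (auto simp: linear_code_def vector_add_ldistrib[symmetric])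
  show "r *s x \<in> (*s) \<gamma> ` C" if "x \<in> (*s) \<gamma> ` C" for r x
  proof -
    obtain c where c: "c \<in> C" "x = \<gamma> *s c" using \<open>x \<in> (*s) \<gamma> ` C\<close> by blast
    obtain r' where "r * \<gamma> = \<gamma> * r'" using gamma_pow_mult_left[of r 1] by auto
    then have "r *s x = \<gamma> *s (r' *s c)" using c(2) by (simp add: vector_smult_assoc)
    then show ?thesis using assms c(1) by (auto simp: linear_code_def)
  qed
qed

text \<open>Expanding the remainder \<open>d\<close> again and again gives it a higher power of
  \<gamma> each time; after \<open>s\<close> rounds it vanishes.\<close>

lemma nakayama:
  fixes C N :: "('a ^ 'n) set"
  assumes N: "linear_code N"
    and C: "\<And>c. c \<in> C \<Longrightarrow> \<exists>x\<in>N. \<exists>d\<in>C. c = x + \<gamma> *s d"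
  shows "C \<subseteq> N"
proof
  fix c assume c: "c \<in> C"
  have "\<exists>x\<in>N. \<exists>d\<in>C. c = x + \<gamma> ^ k *s d" for k
  proof (induction k)
    case 0
    show ?case using c N by (intro bexI[of _ 0] bexI[of _ c]) (auto simp: linear_code_def)
  next
    case (Suc k)
    then obtain x d where xd: "x \<in> N" "d \<in> C" "c = x + \<gamma> ^ k *s d" by blast
    obtain y e where ye: "y \<in> N" "e \<in> C" "d = y + \<gamma> *s e" using C[OF xd(2)] by blast
    have "c = (x + \<gamma> ^ k *s y) + \<gamma> ^ Suc k *s e"
      unfolding xd(3) ye(3)
      by (simp add: vector_add_ldistrib vector_smult_assoc add.assoc power_commutes)
    moreover have "x + \<gamma> ^ k *s y \<in> N" using N xd(1) ye(1) by (simp add: linear_code_def)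
    ultimately show ?case using ye(2) by blast
  qed
  from this[of s] show "c \<in> N" by (auto simp: gamma_pow_s)
qed

text \<open>Fix one lift \<open>?\<tau> a\<close> of each residue class. Every codeword is then
  uniquely a combination of a minimal generating set with lifts as coefficients, plus an element of
  \<gamma> C.\<close>

lemma card_code:
  fixes C :: "('a ^ 'n::finite) set"
  assumes C: "linear_code C"
  shows "card C = CARD('f) ^ code_rank C * card ((*s) \<gamma> ` C)"
proof -
  obtain S where S: "linear_code hull S = C" "card S = code_rank C"
    using code_rank_generators[OF C] by blast
  have SC: "S \<subseteq> C" unfolding S(1)[symmetric] by (rule hull_subset)
  have gC: "linear_code ((*s) \<gamma> ` C)" using C by (rule linear_code_gamma_image)
  have gCC: "(*s) \<gamma> ` C \<subseteq> C" using C by (auto simp: linear_code_def)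
  have span: "\<exists>f. c = (\<Sum>x\<in>S. f x *s x)" if "c \<in> C" for c
    using that linear_code_hull_finite[OF finite, of S] S(1) by auto
  have comb: "(\<Sum>x\<in>S. f x *s x) \<in> C" for f
    using SC C by (intro linear_code_sum) (auto simp: linear_code_def)
  let ?\<tau> = "inv \<pi>"
  have pt: "\<pi> (?\<tau> a) = a" for a using surj_pi by (rule surj_f_inv_f)
  let ?h = "\<lambda>(f, d). (\<Sum>x\<in>S. ?\<tau> (f x) *s x) + d"
  let ?A = "(S \<rightarrow>\<^sub>E (UNIV :: 'f set)) \<times> (*s) \<gamma> ` C"
  \<comment> \<open>If a coefficient of a combination in \<open>\<gamma> C\<close> were a unit, its generator would be
    redundant modulo \<open>\<gamma> C\<close>, hence redundant by Nakayama, against minimality.\<close>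
  have independent: "\<pi> (f y) = 0" if y: "y \<in> S" and f: "(\<Sum>x\<in>S. f x *s x) \<in> (*s) \<gamma> ` C" for f y
  proof (rule ccontr)
    assume "\<pi> (f y) \<noteq> 0"
    then obtain v where v: "v * f y = 1" using unit_if_pi_nonzero by blast
    let ?N = "linear_code hull (S - {y})"
    have N: "linear_code ?N"
      by (rule hull_in) (fastforce simp: linear_code_def)
    have SN: "S - {y} \<subseteq> ?N" by (rule hull_subset)
    let ?R = "\<Sum>x\<in>S - {y}. f x *s x"
    have R: "?R \<in> ?N" using SN N by (intro linear_code_sum) (auto simp: linear_code_def)
    obtain d where d: "d \<in> C" "f y *s y + ?R = \<gamma> *s d"
      using f y by (auto simp: sum.remove[of S y])
    have "v *s (f y *s y + ?R) = y + v *s ?R"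
      using v by (simp add: vector_add_ldistrib vector_smult_assoc)
    \<comment> \<open>Solved for \<open>y\<close>, the relation shows that \<open>y\<close> agrees
      modulo \<gamma> C with an element spanned by the other generators.\<close>
    then have y_eq: "y = - (v *s ?R) + v *s (\<gamma> *s d)"
      using d(2) by (simp add: algebra_simps)
    have "v *s (\<gamma> *s d) \<in> (*s) \<gamma> ` C"
      using gC d(1) by (auto simp: linear_code_def)
    then obtain e where e: "e \<in> C" "v *s (\<gamma> *s d) = \<gamma> *s e" by blast
    have "- (v *s ?R) \<in> ?N"
      using N R by (intro linear_code_uminus) (auto simp: linear_code_def)
    then obtain n where n: "n \<in> ?N" "y = n + \<gamma> *s e"
      using y_eq unfolding e(2) by (rule that)
    have "C \<subseteq> ?N"
    proof (rule nakayama[OF N])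
      fix c assume "c \<in> C"
      then obtain g where "c = (\<Sum>x\<in>S. g x *s x)" using span by blast
      then have "c = g y *s y + (\<Sum>x\<in>S - {y}. g x *s x)" using y by (simp add: sum.remove)
      then have c: "c = (g y *s n + (\<Sum>x\<in>S - {y}. g x *s x)) + g y *s (\<gamma> *s e)"
        by (subst (asm) n(2)) (simp add: vector_add_ldistrib add_ac)
      have "g y *s (\<gamma> *s e) \<in> (*s) \<gamma> ` C" using gC e(1) by (auto simp: linear_code_def)
      then obtain d where "d \<in> C" "g y *s (\<gamma> *s e) = \<gamma> *s d" by blast
      moreover have "(\<Sum>x\<in>S - {y}. g x *s x) \<in> ?N"
        using SN N by (intro linear_code_sum) (auto simp: linear_code_def)
      then have "g y *s n + (\<Sum>x\<in>S - {y}. g x *s x) \<in> ?N"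
        using N n(1) by (auto simp: linear_code_def)
      ultimately show "\<exists>x\<in>?N. \<exists>d\<in>C. c = x + \<gamma> *s d" unfolding c by force
    qed
    moreover have "?N \<subseteq> C" using hull_mono[of "S - {y}" S] S(1) by auto
    ultimately have "code_rank C \<le> card (S - {y})" using code_rank_le[of "S - {y}"] by simp
    then show False using S(2) y by (metis card_Diff1_less finite leD)
  qed
  have "bij_betw ?h ?A C"
  proof (rule bij_betw_imageI)
    show "inj_on ?h ?A"
    proof (rule inj_onI, clarify)
      fix f g c d
      assume f: "f \<in> S \<rightarrow>\<^sub>E UNIV" and g: "g \<in> S \<rightarrow>\<^sub>E UNIV" and cd: "c \<in> C" "d \<in> C"
        and eq: "(\<Sum>x\<in>S. ?\<tau> (f x) *s x) + \<gamma> *s c = (\<Sum>x\<in>S. ?\<tau> (g x) *s x) + \<gamma> *s d"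
      \<comment> \<open>The lift need not be additive, so these coefficients need not be lifts
        themselves; \<open>independent\<close> therefore covers arbitrary ring coefficients.\<close>
      have "(\<Sum>x\<in>S. (?\<tau> (f x) - ?\<tau> (g x)) *s x) = \<gamma> *s d - \<gamma> *s c"
        using eq by (simp add: vector_sub_rdistrib sum_subtractf algebra_simps)
      also have "\<dots> \<in> (*s) \<gamma> ` C" using linear_code_diff[OF gC] cd by blast
      finally have "\<pi> (?\<tau> (f x) - ?\<tau> (g x)) = 0" if "x \<in> S" for x
        using that independent[of x "\<lambda>x. ?\<tau> (f x) - ?\<tau> (g x)"] by simp
      then have "f x = g x" if "x \<in> S" for x using that by (simp add: pi_diff pt)
      then have "f = g" using f g by (intro PiE_ext[of f S "\<lambda>_. UNIV" g]) auto
      with eq show "f = g \<and> \<gamma> *s c = \<gamma> *s d" by simp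
    qed
    show "?h ` ?A = C"
    proof
      show "?h ` ?A \<subseteq> C"
        using comb gCC C by (auto simp: linear_code_def)
      show "C \<subseteq> ?h ` ?A"
      proof
        fix c assume "c \<in> C"
        then obtain f where f: "c = (\<Sum>x\<in>S. f x *s x)" using span by blast
        let ?g = "restrict (\<lambda>x. \<pi> (f x)) S"
        \<comment> \<open>Replacing a coefficient by the lift of its residue leaves an error in the
          kernel. Written with \<gamma> on the left, the error contributes a term of \<gamma>
          C.\<close>
        have "\<exists>r. f x - ?\<tau> (\<pi> (f x)) = \<gamma> * r" for x
          using pi_eq_0_iff' by (metis pi_diff pt cancel_comm_monoid_add_class.diff_cancel)
        then obtain r where r: "\<And>x. f x - ?\<tau> (\<pi> (f x)) = \<gamma> * r x" by metis
        have "c - (\<Sum>x\<in>S. ?\<tau> (?g x) *s x) = (\<Sum>x\<in>S. \<gamma> *s (r x *s x))"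
          by (simp add: f sum_subtractf[symmetric] vector_sub_rdistrib[symmetric] r vector_smult_assoc)
        also have "\<dots> \<in> (*s) \<gamma> ` C"
          using SC C by (intro linear_code_sum[OF gC]) (auto simp: linear_code_def)
        finally have "(?g, c - (\<Sum>x\<in>S. ?\<tau> (?g x) *s x)) \<in> ?A" by simp
        then show "c \<in> ?h ` ?A" by (rule rev_image_eqI) simp
      qed
    qed
  qed
  then have "card ?A = card C" by (rule bij_betw_same_card)
  then show ?thesis by (simp add: card_cartesian_product card_PiE S(2))
qed

lemma card_code_socle:
  fixes C :: "('a ^ 'n::finite) set"
  assumes C: "linear_code C"
  shows "card (code_socle \<gamma> s C) = CARD('f) ^ code_rank C"
proof -
  have "card C = card ((*s) \<gamma> ` C) * card (code_socle \<gamma> s C)"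
    unfolding code_socle_eq
  proof (rule card_additive_image_kernel)
    show "x + y \<in> C" if "x \<in> C" "y \<in> C" for x y using that C by (simp add: linear_code_def)
    show "- x \<in> C" if "x \<in> C" for x using that C by (simp add: linear_code_uminus)
  qed (rule vector_add_ldistrib)
  moreover have "card ((*s) \<gamma> ` C) \<noteq> 0" using C by (auto simp: linear_code_def)
  ultimately show ?thesis using card_code[OF C] by simp
qed

section \<open>The socle as a code over the residue field\<close>

lemma residue_code_eq:
  "residue_code \<pi> \<gamma> s C =
     (\<lambda>r. \<chi> i. \<pi> (r $ i)) ` {r. (\<chi> i. r $ i * \<gamma> ^ (s - 1)) \<in> code_socle \<gamma> s C}"
  by (auto simp: residue_code_def)

text \<open>Presents the socle as an image of the same coefficient vectors that define the residue
  code, so the two can be compared map against map.\<close>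

lemma code_socle_image:
  "code_socle \<gamma> s C =
     (\<lambda>r. \<chi> i. r $ i * \<gamma> ^ (s - 1)) ` {r. (\<chi> i. r $ i * \<gamma> ^ (s - 1)) \<in> code_socle \<gamma> s C}"
proof -
  have "\<exists>r. c = (\<chi> i. r $ i * \<gamma> ^ (s - 1))" if "c \<in> code_socle \<gamma> s C" for c
  proof -
    have "\<forall>i. \<exists>r. c $ i = r * \<gamma> ^ (s - 1)"
      using that by (auto simp: code_socle_def principal_ideal_gamma_pow)
    then obtain r where "\<forall>i. c $ i = r i * \<gamma> ^ (s - 1)" by metis
    then show ?thesis by (intro exI[of _ "\<chi> i. r i"]) (simp add: vec_eq_iff)
  qed
  then show ?thesis by blast
qed

lemma card_residue_code: "card (residue_code \<pi> \<gamma> s C) = card (code_socle \<gamma> s C)"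
proof -
  have "\<pi> x = \<pi> y \<longleftrightarrow> x * \<gamma> ^ (s - 1) = y * \<gamma> ^ (s - 1)" for x y
    using mult_socle_generator_eq_0_iff[of "x - y"] by (simp add: pi_diff left_diff_distrib)
  then show ?thesis
    unfolding residue_code_eq by (subst (2) code_socle_image)
      (rule card_image_eq_if_same_kernel, simp add: vec_eq_iff)
qed

lemma support_residue:
  "support (\<chi> i. \<pi> (r $ i)) = support (\<chi> i. r $ i * \<gamma> ^ (s - 1))"
  by (simp add: support_def mult_socle_generator_eq_0_iff del: One_nat_def)

text \<open>Weight conditions pass between the two codes through this equality, without naming a
  bijection of words.\<close>

lemma support_image_residue_code: "support ` residue_code \<pi> \<gamma> s C = support ` code_socle \<gamma> s C"
  unfolding residue_code_eq by (subst (2) code_socle_image) (simp add: image_image support_residue)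

text \<open>Left scalars commute with right multiplication by \<gamma>^(s-1), so the coefficient
  vectors form a linear code. Its image under \<pi> is closed under field scalars because these lift
  to the ring.\<close>

lemma subspace_residue_code:
  fixes C :: "('a ^ 'n::finite) set"
  assumes C: "linear_code C"
  shows "vec.subspace (residue_code \<pi> \<gamma> s C)"
proof -
  let ?W = "{r. (\<chi> i. r $ i * \<gamma> ^ (s - 1)) \<in> code_socle \<gamma> s C}"
  have mem: "r \<in> ?W \<longleftrightarrow> (\<chi> i. r $ i * \<gamma> ^ (s - 1)) \<in> C" for r
    by (auto simp: code_socle_def principal_ideal_gamma_pow)
  have "(\<chi> i. (0 :: 'a ^ 'n) $ i * \<gamma> ^ (s - 1)) = 0"
    "\<And>r t. (\<chi> i. (r + t) $ i * \<gamma> ^ (s - 1)) =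
       (\<chi> i. r $ i * \<gamma> ^ (s - 1)) + (\<chi> i. t $ i * \<gamma> ^ (s - 1))"
    "\<And>a r. (\<chi> i. (a *s r) $ i * \<gamma> ^ (s - 1)) = a *s (\<chi> i. r $ i * \<gamma> ^ (s - 1))"
    by (simp_all add: vec_eq_iff distrib_right mult.assoc)
  then have W: "linear_code ?W"
    using C unfolding linear_code_def Ball_def mem by metis
  define p :: "'a ^ 'n \<Rightarrow> 'f ^ 'n" where "p r = (\<chi> i. \<pi> (r $ i))" for r
  have p: "0 = p 0" "p r + p t = p (r + t)" "a *s p r = p (inv \<pi> a *s r)" for r t a
    using surj_pi by (simp_all add: p_def vec_eq_iff pi_0 pi_add pi_mult surj_f_inv_f)
  have "vec.subspace (p ` ?W)"
    unfolding vec.subspace_def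
  proof (intro conjI ballI allI)
    show "0 \<in> p ` ?W" by (rule image_eqI[of _ p, OF p(1)]) (use W in \<open>simp only: linear_code_def\<close>)
    show "x + y \<in> p ` ?W" if x: "x \<in> p ` ?W" and y: "y \<in> p ` ?W" for x y
    proof -
      obtain r t where rt: "x = p r" "r \<in> ?W" "y = p t" "t \<in> ?W"
        by (rule imageE[OF x], rule imageE[OF y])
      have "r + t \<in> ?W" using W rt(2,4) unfolding linear_code_def by blast
      then show ?thesis unfolding rt(1,3) p(2) by (rule imageI)
    qed
    show "a *s x \<in> p ` ?W" if x: "x \<in> p ` ?W" for a x
    proof -
      obtain r where r: "x = p r" "r \<in> ?W" by (rule imageE[OF x])
      have "inv \<pi> a *s r \<in> ?W" using W r(2) unfolding linear_code_def by blast
      then show ?thesis unfolding r(1) p(3) by (rule imageI)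
    qed
  qed
  then show ?thesis unfolding residue_code_eq p_def .
qed

lemma dim_residue_code:
  fixes C :: "('a ^ 'n::finite) set"
  assumes C: "linear_code C"
  shows "vec.dim (residue_code \<pi> \<gamma> s C) = code_rank C"
proof -
  have "CARD('f) ^ vec.dim (residue_code \<pi> \<gamma> s C) = CARD('f) ^ code_rank C"
    by (metis C card_subspace subspace_residue_code card_residue_code card_code_socle)
  moreover have "1 < CARD('f)"
    using card_mono[of UNIV "{0, 1 :: 'f}"] by simp
  ultimately show ?thesis by (metis power_inject_exp)
qed

section \<open>Homogeneous weight\<close>

lemma hom_weight_socle:
  fixes C :: "('a ^ 'n::finite) set"
  assumes "c \<in> code_socle \<gamma> s C"
  shows "hom_weight q \<gamma> s c = hom_max q * real (card (support c))"
proof -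
  have "hom_weight q \<gamma> s c = (\<Sum>i\<in>UNIV. if i \<in> support c then hom_max q else 0)"
    unfolding hom_weight_def using assms
    by (intro sum.cong) (auto simp: hom_weight1_def support_def code_socle_def)
  also have "\<dots> = (\<Sum>i\<in>support c. hom_max q)" by (simp add: sum.If_cases)
  finally show ?thesis by simp
qed

lemma hom_weight_ge:
  fixes c :: "'a ^ 'n::finite"
  assumes "1 \<le> hom_max q"
  shows "real (card (support c)) \<le> hom_weight q \<gamma> s c"
proof -
  have "real (card (support c)) = (\<Sum>i\<in>UNIV. if i \<in> support c then 1 else 0)"
    by (simp add: sum.If_cases)
  also have "\<dots> \<le> hom_weight q \<gamma> s c"
    unfolding hom_weight_def using assms
    by (intro sum_mono) (auto simp: hom_weight1_def support_def)
  finally show ?thesis .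
qed

text \<open>Take the last nonzero word among \<open>c\<close>, \<gamma> c, \<gamma>^2 c, and so on:
  one more factor \<gamma> kills it, and scaling never enlarges the support.\<close>

lemma ex_socle_word_supported:
  fixes C :: "('a ^ 'n::finite) set"
  assumes C: "linear_code C" and c: "c \<in> C" "c \<noteq> 0"
  obtains d where "d \<in> code_socle \<gamma> s C" "d \<noteq> 0" "support d \<subseteq> support c"
proof -
  let ?P = "\<lambda>k. \<gamma> ^ k *s c = 0"
  have "?P s" by (simp add: gamma_pow_s)
  moreover have "\<not> ?P 0" using c(2) by simp
  ultimately obtain k where k: "\<not> ?P k" "?P (Suc k)"
    using ex_least_nat_less[of ?P s] by blast
  show ?thesis
  proof
    show "\<gamma> ^ k *s c \<in> code_socle \<gamma> s C"
      using C c k(2) by (auto simp: code_socle_eq linear_code_def vector_smult_assoc)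
    show "\<gamma> ^ k *s c \<noteq> 0" by (rule k(1))
    show "support (\<gamma> ^ k *s c) \<subseteq> support c" by (auto simp: support_def)
  qed
qed

lemma MHD_iff_MDS:
  fixes C :: "('a ^ 'n::finite) set"
  assumes C: "linear_code C" and q: "CARD('n) + 1 < CARD('f) + code_rank C"
  shows "MHD CARD('f) \<gamma> s C \<longleftrightarrow> MDS (residue_code \<pi> \<gamma> s C)"
proof -
  let ?q = "CARD('f)" and ?n = "CARD('n)" and ?K = "code_rank C"
  let ?D = "residue_code \<pi> \<gamma> s C" and ?S = "code_socle \<gamma> s C"
  let ?M = "hom_max ?q"
  have "1 < ?q" using card_mono[of UNIV "{0, 1 :: 'f}"] by simp
  then have q1: "1 < real ?q" by simp
  then have M: "1 \<le> ?M" by (simp add: hom_max_def)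
  have D: "vec.subspace ?D" "vec.dim ?D = ?K"
    using C by (rule subspace_residue_code, rule dim_residue_code)
  have KN: "?K \<le> ?n" using dim_subset_UNIV_cart_gen[of ?D] D(2) by simp
  have zero_S: "0 \<in> ?S" using C by (simp add: code_socle_eq linear_code_def)
  have C0: "0 \<in> C" using C by (simp add: linear_code_def)
  show ?thesis
  proof (cases "C = {0}")
    case True
    then have "?S = {0}" using zero_S by (auto simp: code_socle_eq)
    then have "card ?D = 1" by (simp add: card_residue_code)
    then have D0: "?D = {0}" using vec.subspace_0[OF D(1)] by (metis card_1_singletonE singletonD)
    then have K: "?K = 0" using D(2) by simp
    \<comment> \<open>For the zero code the rank is 0, and the conventional distances M (n + 1) and
      n + 1 make both properties true.\<close>
    have "?M * real ?n < ?M * (real ?n + 1)" using M by simp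
    then have "MHD ?q \<gamma> s C" using C True K unfolding MHD_def hom_distance_def by simp
    moreover have "MDS ?D" using D K unfolding MDS_def by (simp add: hamming_distance_def D0)
    ultimately show ?thesis by simp
  next
    case False
    then have ne: "C - {0} \<noteq> {}" using C0 by blast
    then obtain d where "d \<in> ?S" "d \<noteq> 0" using ex_socle_word_supported[OF C] by blast
    then have "support d \<in> support ` ?D" "support d \<noteq> {}"
      by (simp_all add: support_image_residue_code support_eq_empty_iff)
    then have D0: "?D \<noteq> {0}" by (auto simp: support_def)
    \<comment> \<open>The Singleton bound supplies the other inequality. The natural subtraction is
      exact because \<open>?K \<le> ?n\<close>.\<close>
    have "MDS ?D \<longleftrightarrow> ?n + 1 - ?K \<le> hamming_distance ?D"
      using D(1) singleton_bound[OF D(1) D0] KN unfolding MDS_def D(2) by auto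
    also have "\<dots> \<longleftrightarrow> (\<forall>x\<in>?D - {0}. ?n + 1 - ?K \<le> card (support x))"
      by (rule hamming_distance_ge_iff[OF D(1) D0])
    also have "\<dots> \<longleftrightarrow> (\<forall>A\<in>support ` ?D. A \<noteq> {} \<longrightarrow> ?n + 1 - ?K \<le> card A)"
      by (auto simp: support_eq_empty_iff)
    also have "\<dots> \<longleftrightarrow> (\<forall>x\<in>?S - {0}. ?n + 1 - ?K \<le> card (support x))"
      unfolding support_image_residue_code by (auto simp: support_eq_empty_iff)
    finally have MDS: "MDS ?D \<longleftrightarrow> (\<forall>x\<in>?S - {0}. ?n + 1 - ?K \<le> card (support x))" .
    have MHD: "MHD ?q \<gamma> s C \<longleftrightarrow> (\<forall>c\<in>C - {0}. ?M * (real ?n - real ?K) < hom_weight ?q \<gamma> s c)"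
      using C False ne by (simp add: MHD_def hom_distance_def)
    show ?thesis unfolding MDS MHD
    proof (intro iffI ballI)
      fix x
      assume *: "\<forall>c\<in>C - {0}. ?M * (real ?n - real ?K) < hom_weight ?q \<gamma> s c" and x: "x \<in> ?S - {0}"
      have "?M * (real ?n - real ?K) < hom_weight ?q \<gamma> s x"
        using * x by (auto simp: code_socle_eq)
      also have "\<dots> = ?M * real (card (support x))" using x by (intro hom_weight_socle) auto
      finally have "?M * (real ?n - real ?K) < ?M * real (card (support x))" .
      then have "real ?n - real ?K < real (card (support x))" using M by simp
      then show "?n + 1 - ?K \<le> card (support x)" by linarith
    next
      fix c
      assume *: "\<forall>x\<in>?S - {0}. ?n + 1 - ?K \<le> card (support x)" and c: "c \<in> C - {0}"
      show "?M * (real ?n - real ?K) < hom_weight ?q \<gamma> s c"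
      proof (cases "c \<in> ?S")
        case True
        then have "?n + 1 - ?K \<le> card (support c)" using * c by blast
        then have "real ?n - real ?K < real (card (support c))" using KN by linarith
        then have "?M * (real ?n - real ?K) < ?M * real (card (support c))" using M by simp
        then show ?thesis using hom_weight_socle[OF True] by simp
      next
        case False
        obtain d where d: "d \<in> ?S" "d \<noteq> 0" "support d \<subseteq> support c"
          using ex_socle_word_supported[OF C, of c] c by blast
        have "?n + 1 - ?K \<le> card (support d)" using * d(1,2) by blast
        also have "\<dots> \<le> card (support c)" using d(3) by (simp add: card_mono)
        finally have "?n + 1 - ?K \<le> card (support c)" .
        then have "real ?n - real ?K + 1 \<le> hom_weight ?q \<gamma> s c"
          using hom_weight_ge[OF M, of c] KN by linarith
        \<comment> \<open>The right side minus the left side is q - (n - K + 1), so this is the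
          hypothesis on q cleared of denominators.\<close>
        moreover have "real ?q * (real ?n - real ?K) < (real ?n - real ?K + 1) * (real ?q - 1)"
          using q by (simp add: algebra_simps)
        then have "?M * (real ?n - real ?K) < real ?n - real ?K + 1"
          using q1 by (simp add: hom_max_def divide_less_eq)
        ultimately show ?thesis by linarith
      qed
    qed
  qed
qed

end

theorem theorem17:
  fixes \<gamma> :: "'a::{finite,ring_1}" and s q n K :: nat
    and \<pi> :: "'a \<Rightarrow> 'f::{finite,field}"
    and C :: "('a ^ 'n::finite) set"
  assumes "chain_ring TYPE('a)"
    and "maximal_ideal (principal_ideal \<gamma>)"
    and "principal_ideal \<gamma> = range (\<lambda>r. \<gamma> * r)"
    and "principal_ideal \<gamma> = range (\<lambda>r. r * \<gamma>)"
    and "nilpotency_index \<gamma> s"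
    and "quotient_map (principal_ideal \<gamma>) \<pi>"
    and "q = CARD('f)"
    and "n = CARD('n)"
    and "linear_code C"
    and "code_rank C = K"
    and "int q > int n - int K + 1"
  shows "MHD q \<gamma> s C \<longleftrightarrow> MDS (residue_code \<pi> \<gamma> s C)"
proof -
  \<comment> \<open>Equating the left and right descriptions of the ideal of \<gamma> yields
    \<open>range_comm\<close>.\<close>
  interpret residue_field_map \<gamma> s \<pi>
    using assms by unfold_locales auto
  show ?thesis using MHD_iff_MDS[of C] assms by simp
qed

end
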